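(* Let $(V,M)$ be an analytic pair. Then $$E_{V,M}(p,\xi)\le F_{V,M}(p,\xi)$$ for every $p\in V$ and $\xi\in T_pV$.
   Context: An analytic pair of dimension $n$ is a pair $(V,M)$ where $M$ is a connected complex manifold of complex dimension $n$ and $V\subset M$ is a closed totally real analytic submanifold of real dimension $n$; $J$ denotes the complex structure of $TM$. $\mathcal U(V,M)$ is the class of all plurisubharmonic functions $u:M\to[0,\pi/4[$ with $u(p)=0$ for every $p\in V$. For $p\in M$, $\eta\in T_pM$, $\Gamma_M(p,\eta)$ is the set of $C^1$ maps $\gamma:\,]-\varepsilon,\varepsilon[\,\to M$ (for some $\varepsilon>0$) with $\gamma(0)=p$, $\gamma'(0)=\eta$. For $p\in V$, $\xi\in T_pV$, $u\in\mathcal U(V,M)$, $$E_{u,M}(p,\xi)=\inf_{\gamma\in\Gamma_M(p,J\xi)}\limsup_{t\to0^+}\frac{u(\gamma(t))}{t},\qquad E_{V,M}(p,\xi)=\sup_{u\in\mathcal U(V,M)}E_{u,M}(p,\xi).$$ With $\Delta$ the open unit disc in $\mathbb C$, $$F_{V,M}(p,\xi)=\inf\{a>0\mid \exists f:\Delta\to M \text{ holomorphic},\ f(]-1,1[)\subset V,\ f(0)=p,\ f'(0)=a^{-1}\xi\}.$$ *)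

theory Defs
  imports "HOL-Analysis.Analysis"
begin

section \<open>Complex manifolds\<close>

text \<open>
  The underlying space of a complex manifold of dimension \<open>CARD('n)\<close> is a Hausdorff second
  countable type \<open>'m\<close>.  A chart is a pair of its domain and its coordinate map; the values of
  the coordinate map outside the domain are irrelevant.
\<close>

type_synonym ('m, 'n) chart = "'m set \<times> ('m \<Rightarrow> complex ^ 'n)"

definition holomorphic_map_on :: "(complex ^ 'n::finite \<Rightarrow> complex ^ 'k::finite) \<Rightarrow> (complex ^ 'n) set \<Rightarrow> bool"
  where "holomorphic_map_on f S \<longleftrightarrow>
    (\<forall>x\<in>S. \<exists>D. (f has_derivative D) (at x) \<and> (\<forall>c v. D (c *s v) = c *s D v))"

definition is_chart :: "('m::topological_space, 'n::finite) chart \<Rightarrow> bool"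
  where "is_chart = (\<lambda>(U, \<phi>). open U \<and> open (\<phi> ` U) \<and> (\<exists>\<psi>. homeomorphism U (\<phi> ` U) \<phi> \<psi>))"

definition transition :: "('m, 'n::finite) chart \<Rightarrow> ('m, 'n) chart \<Rightarrow> complex ^ 'n \<Rightarrow> complex ^ 'n"
  where "transition c d = snd d \<circ> inv_into (fst c) (snd c)"

definition compatible :: "('m, 'n::finite) chart \<Rightarrow> ('m, 'n) chart \<Rightarrow> bool"
  where "compatible c d \<longleftrightarrow>
    holomorphic_map_on (transition c d) (snd c ` (fst c \<inter> fst d)) \<and>
    holomorphic_map_on (transition d c) (snd d ` (fst c \<inter> fst d))"

text \<open>A complex structure is a maximal holomorphic atlas.\<close>

definition complex_structure :: "('m::{t2_space, second_countable_topology}, 'n::finite) chart set \<Rightarrow> bool"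
  where "complex_structure A \<longleftrightarrow>
    (\<forall>c\<in>A. is_chart c) \<and>
    (\<Union>c\<in>A. fst c) = UNIV \<and>
    (\<forall>c\<in>A. \<forall>d\<in>A. compatible c d) \<and>
    (\<forall>c. is_chart c \<and> (\<forall>d\<in>A. compatible c d) \<longrightarrow> c \<in> A)"


section \<open>Tangent vectors and curves\<close>

text \<open>
  A tangent vector at \<open>p\<close> is given by its components in all the charts around \<open>p\<close>, which have to
  transform by the differentials of the coordinate changes.  It is normalized to be \<open>0\<close> on
  the other charts, so that equality of tangent vectors is equality of functions.
\<close>

type_synonym ('m, 'n) tangent = "('m, 'n) chart \<Rightarrow> complex ^ 'n"

definition tangent_space :: "('m, 'n::finite) chart set \<Rightarrow> 'm \<Rightarrow> ('m, 'n) tangent set"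
  where "tangent_space A p = {\<eta>.
    (\<forall>c\<in>A. \<forall>d\<in>A. p \<in> fst c \<inter> fst d \<longrightarrow>
        \<eta> d = frechet_derivative (transition c d) (at (snd c p)) (\<eta> c)) \<and>
    (\<forall>c. \<not> (c \<in> A \<and> p \<in> fst c) \<longrightarrow> \<eta> c = 0)}"

definition J :: "('m, 'n::finite) tangent \<Rightarrow> ('m, 'n) tangent"
  where "J \<eta> = (\<lambda>c. \<i> *s \<eta> c)"

text \<open>
  C1 maps from the interval \<open>]-\<epsilon>, \<epsilon>[\<close> to the manifold, with a given base point and initial
  velocity; functions on the interval are represented by functions on the whole line.
\<close>

definition C1_curve :: "('m::topological_space, 'n::finite) chart set \<Rightarrow> real \<Rightarrow> (real \<Rightarrow> 'm) \<Rightarrow> bool"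
  where "C1_curve A \<epsilon> \<gamma> \<longleftrightarrow> continuous_on {-\<epsilon><..<\<epsilon>} \<gamma> \<and>
    (\<forall>(U, \<phi>)\<in>A. (\<lambda>t. \<phi> (\<gamma> t)) C1_differentiable_on {t \<in> {-\<epsilon><..<\<epsilon>}. \<gamma> t \<in> U})"

definition curves :: "('m::topological_space, 'n::finite) chart set \<Rightarrow> 'm \<Rightarrow> ('m, 'n) tangent \<Rightarrow> (real \<Rightarrow> 'm) set"
  where "curves A p \<eta> = {\<gamma>. (\<exists>\<epsilon>>0. C1_curve A \<epsilon> \<gamma>) \<and> \<gamma> 0 = p \<and>
    (\<forall>c\<in>A. p \<in> fst c \<longrightarrow> ((\<lambda>t. snd c (\<gamma> t)) has_vector_derivative \<eta> c) (at 0))}"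


section \<open>Analytic pairs\<close>

text \<open>
  Real analyticity on an open set: local expansion in a convergent multiple power series.  The
  functions \<open>\<alpha>\<close> are the multi-indices.
\<close>

definition real_analytic_on :: "(real ^ 'k::finite \<Rightarrow> 'b::real_normed_vector) \<Rightarrow> (real ^ 'k) set \<Rightarrow> bool"
  where "real_analytic_on f S \<longleftrightarrow>
    (\<forall>x\<in>S. \<exists>r>0. \<exists>a :: ('k \<Rightarrow> nat) \<Rightarrow> 'b. \<forall>h. norm h < r \<longrightarrow>
       ((\<lambda>\<alpha>. (\<Prod>i\<in>UNIV. (h $ i) ^ \<alpha> i) *\<^sub>R a \<alpha>) has_sum f (x + h)) UNIV)"

text \<open>
  An (embedded) real analytic submanifold of real dimension \<open>CARD('n)\<close> is locally, in charts, the
  image of a real analytic immersion which is a homeomorphism onto it.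
\<close>

definition real_analytic_submanifold :: "('m::topological_space, 'n::finite) chart set \<Rightarrow> 'm set \<Rightarrow> bool"
  where "real_analytic_submanifold A V \<longleftrightarrow>
    (\<forall>p\<in>V. \<exists>(U, \<phi>)\<in>A. p \<in> U \<and>
      (\<exists>(W :: (real ^ 'n) set) (\<psi> :: real ^ 'n \<Rightarrow> complex ^ 'n) \<psi>'.
         open W \<and> real_analytic_on \<psi> W \<and>
         (\<forall>x\<in>W. \<exists>D. (\<psi> has_derivative D) (at x) \<and> inj D) \<and>
         homeomorphism W (\<phi> ` (U \<inter> V)) \<psi> \<psi>'))"

definition submanifold_tangent_space ::
    "('m::topological_space, 'n::finite) chart set \<Rightarrow> 'm set \<Rightarrow> 'm \<Rightarrow> ('m, 'n) tangent set"
  where "submanifold_tangent_space A V p =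
    {\<xi> \<in> tangent_space A p. \<exists>\<gamma>\<in>curves A p \<xi>. \<exists>\<epsilon>>0. \<forall>t. \<bar>t\<bar> < \<epsilon> \<longrightarrow> \<gamma> t \<in> V}"

definition totally_real :: "('m::topological_space, 'n::finite) chart set \<Rightarrow> 'm set \<Rightarrow> bool"
  where "totally_real A V \<longleftrightarrow>
    (\<forall>p\<in>V. submanifold_tangent_space A V p \<inter> J ` submanifold_tangent_space A V p = {\<lambda>c. 0})"

definition analytic_pair ::
    "'m set \<Rightarrow> ('m::{t2_space, second_countable_topology}, 'n::finite) chart set \<Rightarrow> bool"
  where "analytic_pair V A \<longleftrightarrow>
    complex_structure A \<and> connected (UNIV :: 'm set) \<and>
    closed V \<and> real_analytic_submanifold A V \<and> totally_real A V"


section \<open>Plurisubharmonic functions\<close>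

text \<open>
  Only finite valued plurisubharmonic functions are needed.  For an upper semicontinuous function
  which is finite at the centre \<open>a\<close>, the inequality with the circular mean (an element of
  \<open>[-\<infinity>, \<infinity>[\<close>) forces the mean to be finite, whence the integrability clause; for bounded upper
  semicontinuous functions the clause holds automatically.
\<close>

definition plurisubharmonic_on :: "(complex ^ 'n::finite \<Rightarrow> real) \<Rightarrow> (complex ^ 'n) set \<Rightarrow> bool"
  where "plurisubharmonic_on w \<Omega> \<longleftrightarrow>
    (\<forall>b. open {x \<in> \<Omega>. w x < b}) \<and>
    (\<forall>a v. (\<forall>\<zeta>::complex. norm \<zeta> \<le> 1 \<longrightarrow> a + \<zeta> *s v \<in> \<Omega>) \<longrightarrow>
       set_integrable lborel {0..2 * pi} (\<lambda>\<theta>. w (a + cis \<theta> *s v)) \<and>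
       w a \<le> (LBINT \<theta>:{0..2 * pi}. w (a + cis \<theta> *s v)) / (2 * pi))"

definition plurisubharmonic :: "('m, 'n::finite) chart set \<Rightarrow> ('m \<Rightarrow> real) \<Rightarrow> bool"
  where "plurisubharmonic A u \<longleftrightarrow>
    (\<forall>(U, \<phi>)\<in>A. plurisubharmonic_on (u \<circ> inv_into U \<phi>) (\<phi> ` U))"

definition psh_class :: "'m set \<Rightarrow> ('m, 'n::finite) chart set \<Rightarrow> ('m \<Rightarrow> real) set"
  where "psh_class V A =
    {u. plurisubharmonic A u \<and> (\<forall>x. 0 \<le> u x \<and> u x < pi / 4) \<and> (\<forall>p\<in>V. u p = 0)}"


section \<open>The two infinitesimal pseudometrics\<close>

definition E_fun ::
    "('m \<Rightarrow> real) \<Rightarrow> ('m::topological_space, 'n::finite) chart set \<Rightarrow> 'm \<Rightarrow> ('m, 'n) tangent \<Rightarrow> ereal"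
  where "E_fun u A p \<xi> =
    (INF \<gamma>\<in>curves A p (J \<xi>). Limsup (at_right 0) (\<lambda>t. ereal (u (\<gamma> t) / t)))"

definition E_pair ::
    "'m set \<Rightarrow> ('m::topological_space, 'n::finite) chart set \<Rightarrow> 'm \<Rightarrow> ('m, 'n) tangent \<Rightarrow> ereal"
  where "E_pair V A p \<xi> = (SUP u\<in>psh_class V A. E_fun u A p \<xi>)"

definition holomorphic_disc :: "('m::topological_space, 'n::finite) chart set \<Rightarrow> (complex \<Rightarrow> 'm) \<Rightarrow> bool"
  where "holomorphic_disc A f \<longleftrightarrow> continuous_on (ball 0 1) f \<and>
    (\<forall>(U, \<phi>)\<in>A. \<forall>i. (\<lambda>z. \<phi> (f z) $ i) holomorphic_on {z \<in> ball 0 1. f z \<in> U})"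

definition disc_velocity_at_0 ::
    "('m, 'n::finite) chart set \<Rightarrow> (complex \<Rightarrow> 'm) \<Rightarrow> ('m, 'n) tangent \<Rightarrow> bool"
  where "disc_velocity_at_0 A f \<eta> \<longleftrightarrow>
    (\<forall>c\<in>A. f 0 \<in> fst c \<longrightarrow> (\<forall>i. ((\<lambda>z. snd c (f z) $ i) has_field_derivative \<eta> c $ i) (at 0)))"

definition F_pair ::
    "'m set \<Rightarrow> ('m::topological_space, 'n::finite) chart set \<Rightarrow> 'm \<Rightarrow> ('m, 'n) tangent \<Rightarrow> ereal"
  where "F_pair V A p \<xi> = Inf {ereal a | a::real. a > 0 \<and>
    (\<exists>f. holomorphic_disc A f \<and> (\<forall>x::real. -1 < x \<and> x < 1 \<longrightarrow> f (complex_of_real x) \<in> V) \<and>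
         f 0 = p \<and> disc_velocity_at_0 A f (\<lambda>c. inverse a *\<^sub>R \<xi> c))}"

end

theory Submission
  imports Defs "HOL-Complex_Analysis.Complex_Singularities"
begin

text \<open>Let \<open>f\<close> be a disc admissible for \<open>F\<close> with constant \<open>a\<close>, and \<open>u\<close> admissible for \<open>E\<close>.  The curve
  \<open>t \<mapsto> f (\<i> a t)\<close> has velocity \<open>J \<xi>\<close>, and \<open>u \<circ> f\<close> is subharmonic, vanishes on the real diameter and is
  at most \<open>\<pi>/4\<close>.  Comparison on the upper half disc with the harmonic function having boundary values
  \<open>0\<close> on the diameter and \<open>\<pi>/4\<close> on the half circle gives \<open>u (f (\<i> s)) \<le> arctan s \<le> s\<close>, hence the bound
  \<open>a\<close> for the upper limit along the curve.

  Subharmonicity of \<open>u \<circ> f\<close> is needed only away from the critical points of \<open>f\<close>, where a chart of the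
  maximal atlas turns \<open>f\<close> into a complex line.  The critical points are discrete when
  \<open>f\<close> is not critical at \<open>0\<close>, that is when \<open>\<xi> \<noteq> 0\<close>, and are removed by a logarithmic perturbation.\<close>

section \<open>The maximum principle on the half disc\<close>

text \<open>The radius is a complex number, so that the property is stable under \<open>v \<mapsto> v (e * _)\<close> for
  complex \<open>e\<close>.\<close>

definition submean_at :: "(complex \<Rightarrow> real) \<Rightarrow> complex \<Rightarrow> complex \<Rightarrow> bool" where
  "submean_at v z a \<longleftrightarrow>
     set_integrable lborel {0..2 * pi} (\<lambda>\<theta>. v (z + a * cis \<theta>)) \<and>
     v z \<le> (LBINT \<theta>:{0..2 * pi}. v (z + a * cis \<theta>)) / (2 * pi)"

text \<open>Otherwise every \<open>x\<close> has a point \<open>Y x\<close> of larger value, and the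
  relatively open sets where \<open>g < g (Y x)\<close> cover \<open>K\<close>. In a finite subcover
  the largest of the values \<open>g (Y x)\<close> is taken at a point that lies in none of the
  sets.\<close>

lemma usc_attains_max:
  fixes g :: "'a::topological_space \<Rightarrow> real"
  assumes "compact K" "K \<noteq> {}"
    and usc: "\<And>x b. x \<in> K \<Longrightarrow> g x < b \<Longrightarrow> \<forall>\<^sub>F y in at x within K. g y < b"
  obtains x where "x \<in> K" "\<And>y. y \<in> K \<Longrightarrow> g y \<le> g x"
proof (rule ccontr)
  assume "\<not> thesis"
  then have "\<forall>x\<in>K. \<exists>y\<in>K. g x < g y"
    using that by (meson not_le)
  then obtain Y where Y: "\<And>x. x \<in> K \<Longrightarrow> Y x \<in> K \<and> g x < g (Y x)" by metis
  have "\<exists>T. open T \<and> x \<in> T \<and> (\<forall>z\<in>T \<inter> K. g z < g (Y x))" if x: "x \<in> K" for x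
  proof -
    obtain T where T: "open T" "x \<in> T" "\<And>z. z \<in> T \<Longrightarrow> z \<noteq> x \<Longrightarrow> z \<in> K \<Longrightarrow> g z < g (Y x)"
      using usc[OF x, of "g (Y x)"] Y[OF x] unfolding eventually_at_topological by blast
    have "g z < g (Y x)" if "z \<in> T \<inter> K" for z
      using T(3)[of z] that Y[OF x] by (cases "z = x") auto
    with T(1,2) show ?thesis by blast
  qed
  then obtain T where T: "\<And>x. x \<in> K \<Longrightarrow> open (T x) \<and> x \<in> T x \<and> (\<forall>z\<in>T x \<inter> K. g z < g (Y x))"
    by metis
  obtain F where F: "F \<subseteq> K" "finite F" "K \<subseteq> (\<Union>x\<in>F. T x)"
    using compactE_image[OF \<open>compact K\<close>, of K T] T by blast
  then have "F \<noteq> {}" using \<open>K \<noteq> {}\<close> by auto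
  then obtain m where m: "m \<in> F" "\<And>x. x \<in> F \<Longrightarrow> g (Y x) \<le> g (Y m)"
  proof -
    have "Max ((\<lambda>x. g (Y x)) ` F) \<in> (\<lambda>x. g (Y x)) ` F"
      using F(2) \<open>F \<noteq> {}\<close> by (intro Max_in) auto
    then obtain m where "m \<in> F" "g (Y m) = Max ((\<lambda>x. g (Y x)) ` F)" by force
    then show thesis using that F(2) Max_ge[of "(\<lambda>x. g (Y x)) ` F"] by simp
  qed
  have "Y m \<in> K" using Y m F by blast
  then obtain x where "x \<in> F" "Y m \<in> T x" using F by blast
  then have "g (Y m) < g (Y x)" using T F \<open>Y m \<in> K\<close> by blast
  with m(2)[OF \<open>x \<in> F\<close>] show False by simp
qed

section \<open>Mean values over circles\<close>

lemma holomorphic_circle_mean: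
  assumes G: "G holomorphic_on ball z R" and r: "0 < r" "r < R"
  shows "((\<lambda>t. G (z + of_real r * cis t)) has_integral of_real (2 * pi) * G z) {0..2 * pi}"
proof -
  have "G holomorphic_on cball z r"
    using G by (rule holomorphic_on_subset) (use r in auto)
  then have "((\<lambda>u. G u / (u - z)) has_contour_integral (2 * of_real pi * \<i> * G z)) (circlepath z r)"
    using r by (intro Cauchy_integral_circlepath_simple) auto
  then have "((\<lambda>t. G (z + r * cis t) / (z + r * cis t - z) * r * \<i> * cis t) has_integral
      2 * of_real pi * \<i> * G z) {0..2 * pi}"
    unfolding circlepath_def by (subst (asm) has_contour_integral_part_circlepath_iff) auto
  \<comment> \<open>The velocity \<open>r * \<i> * cis t\<close> of the circle cancels the
    denominator of Cauchy's formula up to \<open>\<i>\<close>, which the factor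
    \<open>- \<i>\<close> removes.\<close>
  then have "((\<lambda>t. (- \<i>) * (G (z + r * cis t) / (z + r * cis t - z) * r * \<i> * cis t)) has_integral
      (- \<i>) * (2 * of_real pi * \<i> * G z)) {0..2 * pi}"
    by (rule has_integral_mult_right)
  then show ?thesis
    by (rule has_integral_eq_rhs[OF has_integral_eq, rotated])
       (use r in \<open>auto simp: field_simps\<close>)
qed

text \<open>Recasts Cauchy's formula as a Lebesgue integral over \<open>lborel\<close>, the form
  used by \<open>submean_at\<close>.\<close>

lemma harmonic_circle_mean:
  assumes G: "G holomorphic_on ball z R" and r: "0 < r" "r < R"
  shows "set_integrable lborel {0..2 * pi} (\<lambda>t. Re (G (z + of_real r * cis t)))"
    and "(LBINT t:{0..2 * pi}. Re (G (z + of_real r * cis t))) = 2 * pi * Re (G z)"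
proof -
  have "continuous_on (ball z R) G"
    using G by (rule holomorphic_on_imp_continuous_on)
  then have "continuous_on {0..2 * pi} (\<lambda>t. G (z + of_real r * cis t))"
    by (rule continuous_on_compose2) (use r in \<open>auto intro!: continuous_intros simp: dist_norm norm_mult\<close>)
  then have "continuous_on {0..2 * pi} (\<lambda>t. Re (G (z + of_real r * cis t)))"
    by (intro continuous_intros)
  then show *: "set_integrable lborel {0..2 * pi} (\<lambda>t. Re (G (z + of_real r * cis t)))"
    by (rule borel_integrable_atLeastAtMost')
  have "((\<lambda>t. Re (G (z + of_real r * cis t))) has_integral Re (of_real (2 * pi) * G z)) {0..2 * pi}"
    using has_integral_linear[OF holomorphic_circle_mean[OF assms] bounded_linear_Re]
    by (simp add: o_def)
  moreover have "((\<lambda>t. Re (G (z + of_real r * cis t))) has_integral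
      (LBINT t:{0..2 * pi}. Re (G (z + of_real r * cis t)))) {0..2 * pi}"
    using set_borel_integral_eq_integral[OF *] integrable_integral by simp
  ultimately have "Re (of_real (2 * pi) * G z) = (LBINT t:{0..2 * pi}. Re (G (z + of_real r * cis t)))"
    by (rule has_integral_unique)
  then show "(LBINT t:{0..2 * pi}. Re (G (z + of_real r * cis t))) = 2 * pi * Re (G z)"
    by simp
qed

text \<open>\<open>Re G\<close> equals its mean over the circle and \<open>v\<close> is at most its
  mean, while the mean of \<open>(norm w)\<^sup>2\<close> exceeds its value at \<open>z\<close> by
  \<open>r\<^sup>2\<close>. So the values of the sum on the circle cannot all be at most the value
  at the centre.\<close>

lemma strict_max_contradiction:
  assumes G: "G holomorphic_on ball z R" and r: "0 < r" "r < R" and "\<delta> > 0"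
    and v: "submean_at v z (of_real r)"
    and le: "\<And>w. dist w z = r \<Longrightarrow>
      v w + Re (G w) + \<delta> * (norm w)\<^sup>2 \<le> v z + Re (G z) + \<delta> * (norm z)\<^sup>2"
  shows False
proof -
  define m where "m = v z + Re (G z) + \<delta> * (norm z)\<^sup>2"
  \<comment> \<open>The last bracket expands \<open>norm (z + (w - z))\<close> squared for
    \<open>norm (w - z) = r\<close>, with \<open>2 * cnj z * (w - z)\<close> in place of its real
    part. Hence \<open>H\<close> is holomorphic and \<open>v \<le> Re H\<close> on the
    circle.\<close>
  define H where "H = (\<lambda>w. of_real m - G w - of_real \<delta> * (of_real ((norm z)\<^sup>2 + r\<^sup>2) + 2 * cnj z * (w - z)))"
  have H: "H holomorphic_on ball z R"
    unfolding H_def using G by (intro holomorphic_intros)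
  have on_circle: "v (z + of_real r * cis t) \<le> Re (H (z + of_real r * cis t))" for t
  proof -
    let ?w = "z + of_real r * cis t"
    have "(norm ?w)\<^sup>2 = (norm z)\<^sup>2 + r\<^sup>2 + Re (2 * cnj z * (?w - z))"
    proof -
      have "r * (r * (cos t * cos t)) + r * (r * (sin t * sin t)) = r * r"
        by (simp flip: distrib_left)
      then have "(norm ?w)\<^sup>2 = (Re z)\<^sup>2 + (Im z)\<^sup>2 + r\<^sup>2 + 2 * r * (Re z * cos t + Im z * sin t)"
        unfolding cmod_power2 by (simp add: power2_eq_square algebra_simps)
      then show ?thesis
        unfolding cmod_power2 by (simp add: algebra_simps)
    qed
    then have "Re (H ?w) = m - Re (G ?w) - \<delta> * (norm ?w)\<^sup>2"
      by (simp add: H_def)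
    moreover have "dist ?w z = r" using r by (simp add: dist_norm norm_mult)
    ultimately show ?thesis using le[of ?w] unfolding m_def by linarith
  qed
  have "(LBINT \<theta>:{0..2 * pi}. v (z + of_real r * cis \<theta>)) \<le> (LBINT \<theta>:{0..2 * pi}. Re (H (z + of_real r * cis \<theta>)))"
    using v harmonic_circle_mean(1)[OF H r] on_circle
    by (intro set_integral_mono) (auto simp: submean_at_def)
  also have "\<dots> = 2 * pi * Re (H z)"
    by (rule harmonic_circle_mean(2)[OF H r])
  finally have "(LBINT \<theta>:{0..2 * pi}. v (z + of_real r * cis \<theta>)) \<le> Re (H z) * (2 * pi)"
    by (simp add: mult.commute)
  moreover have "v z * (2 * pi) \<le> (LBINT \<theta>:{0..2 * pi}. v (z + of_real r * cis \<theta>))"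
    using v by (simp add: submean_at_def pos_le_divide_eq)
  ultimately have "v z * (2 * pi) \<le> Re (H z) * (2 * pi)" by linarith
  then have "v z \<le> Re (H z)" by (rule mult_right_le_imp_le) simp
  also have "Re (H z) = v z - \<delta> * r\<^sup>2"
    by (simp add: H_def m_def algebra_simps)
  finally show False using \<open>\<delta> > 0\<close> r by (simp add: mult_le_0_iff)
qed

section \<open>Boundary values of \<open>Re (Arctan z)\<close> on the right half disc\<close>

lemma Re_Arctan_eq_Im_Ln:
  "Re (Arctan z) = - Im (Ln ((1 - \<i> * z) / (1 + \<i> * z))) / 2"
  by (simp add: Arctan_def)

text \<open>This Moebius transform takes the unit disc to the right half plane and the right half
  disc to the fourth quadrant; the diameter and the half circle become its two edges.
  \<open>Re (Arctan z)\<close> is minus half the argument there.\<close>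

lemma Arctan_moebius_parts:
  "Re ((1 - \<i> * z) / (1 + \<i> * z)) = (1 - (norm z)\<^sup>2) / (norm (1 + \<i> * z))\<^sup>2"
  "Im ((1 - \<i> * z) / (1 + \<i> * z)) = - 2 * Re z / (norm (1 + \<i> * z))\<^sup>2"
  unfolding cmod_power2 Re_divide Im_divide by (simp_all add: power2_eq_square algebra_simps)

lemma Re_Arctan_nonneg:
  assumes "norm z \<le> 1" "Re z \<ge> 0" "z \<noteq> \<i>" "z \<noteq> - \<i>"
  shows "Re (Arctan z) \<ge> 0"
proof -
  define q where "q = (1 - \<i> * z) / (1 + \<i> * z)"
  have "(norm z)\<^sup>2 \<le> 1" using assms by (simp add: power_le_one)
  then have q: "Re q \<ge> 0" "Im q \<le> 0"
    using assms unfolding q_def Arctan_moebius_parts by simp_all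
  \<comment> \<open>The numerator vanishes only at \<open>- \<i>\<close> and the denominator only at
    \<open>\<i>\<close>, the two excluded corners.\<close>
  have "1 - \<i> * z \<noteq> 0" "1 + \<i> * z \<noteq> 0"
    using assms by (auto simp: complex_eq_iff)
  then have "q \<noteq> 0" by (simp add: q_def)
  then have "Im (Ln q) \<le> 0"
    using q Im_Ln_eq_0[of q] Re_Ln_pos_le[of q] Im_Ln_pos_lt[of q] pi_gt_zero
    by linarith
  then show ?thesis by (simp add: Re_Arctan_eq_Im_Ln q_def)
qed

text \<open>On the half circle the transform lies on the negative imaginary axis, where the argument
  is \<open>- (pi / 2)\<close>.\<close>

lemma Re_Arctan_unit_circle:
  assumes "norm z = 1" "Re z > 0"
  shows "Re (Arctan z) = pi / 4"
proof -
  define q where "q = (1 - \<i> * z) / (1 + \<i> * z)"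
  have "1 + \<i> * z \<noteq> 0" using assms(2) by (auto simp: complex_eq_iff)
  then have q: "Re q = 0" "Im q < 0"
    using assms unfolding q_def Arctan_moebius_parts by (simp_all add: field_simps)
  then have "q \<noteq> 0" by auto
  with q have "Im (Ln q) = - (pi / 2)"
    by (subst Im_Ln_eq) auto
  then show ?thesis by (simp add: Re_Arctan_eq_Im_Ln q_def)
qed

section \<open>Comparison with \<open>Re (Arctan z)\<close> on the half disc\<close>

lemma usc_add_continuous:
  fixes v k :: "'a::topological_space \<Rightarrow> real"
  assumes v: "\<And>b. v x < b \<Longrightarrow> \<forall>\<^sub>F y in F. v y < b"
    and k: "(k \<longlongrightarrow> k x) F" and b: "v x + k x < b"
  shows "\<forall>\<^sub>F y in F. v y + k y < b"
proof -
  \<comment> \<open>Half of the gap below \<open>b\<close> is allotted to each summand.\<close>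
  define e where "e = (b - v x - k x) / 2"
  have "e > 0" using b by (simp add: e_def)
  then have "\<forall>\<^sub>F y in F. v y < v x + e" "\<forall>\<^sub>F y in F. k y < k x + e"
    using v order_tendstoD(2)[OF k] by auto
  then show ?thesis
    by eventually_elim (simp add: e_def field_simps)
qed

text \<open>The points of \<open>C\<close> carry no submean assumption.  A term \<open>\<epsilon> ln \<bar>P\<bar> \<le> 0\<close> with poles at \<open>C\<close>, added
  to \<open>v\<close>, keeps the maximum away from them; the term \<open>\<epsilon> (\<bar>z\<bar>\<^sup>2 - 1)\<close> makes the submean inequality
  strict.\<close>

lemma half_disc_bound:
  fixes v :: "complex \<Rightarrow> real"
  assumes C: "finite C" "C \<subseteq> cball 0 1"
    and usc: "\<And>x b. norm x \<le> 1 \<Longrightarrow> v x < b \<Longrightarrow> \<forall>\<^sub>F y in at x within cball 0 1. v y < b"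
    and zero: "\<And>x. norm x \<le> 1 \<Longrightarrow> Re x = 0 \<Longrightarrow> v x = 0"
    and bd: "\<And>x. norm x \<le> 1 \<Longrightarrow> v x \<le> pi / 4"
    and sub: "\<And>x. norm x < 1 \<Longrightarrow> Re x > 0 \<Longrightarrow> x \<notin> C \<Longrightarrow>
               \<exists>R>0. \<forall>r. 0 < r \<and> r < R \<longrightarrow> submean_at v x (of_real r)"
    and x: "norm x < 1" "Re x > 0" "x \<notin> C"
  shows "v x \<le> Re (Arctan x)"
proof -
  \<comment> \<open>Points of the closed unit disc are at distance at most 2, so dividing each
    factor by 2 gives \<open>norm (P z) \<le> 1\<close> and a nonpositive logarithm.\<close>
  define P where "P = (\<lambda>z::complex. \<Prod>c\<in>C. (z - c) / 2)"
  have P_holo: "P holomorphic_on S" for S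
    unfolding P_def by (intro holomorphic_intros) auto
  have P_cont: "continuous_on S P" for S
    using P_holo by (rule holomorphic_on_imp_continuous_on)
  have P_eq_0: "P z = 0 \<longleftrightarrow> z \<in> C" for z
    using C by (auto simp: P_def)
  have P_le: "norm (P z) \<le> 1" if "norm z \<le> 1" for z
  proof -
    have "norm ((z - c) / 2) \<le> 1" if "c \<in> C" for c
      using norm_triangle_ineq4[of z c] \<open>norm z \<le> 1\<close> C that by (auto simp: norm_divide)
    then show ?thesis
      unfolding P_def prod_norm[symmetric] by (intro prod_le_1) auto
  qed
  \<comment> \<open>The \<open>Arctan\<close> bound is harmonic with boundary values 0 on the imaginary axis and \<open>pi / 4\<close> on the
    half circle.  At the two corners \<open>\<plusminus>\<i>\<close> the value of \<open>Arctan\<close> is junk.\<close>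
  define h where "h = (\<lambda>z. if z = \<i> \<or> z = - \<i> then 0 else Re (Arctan z))"
  have h_nonneg: "h z \<ge> 0" if "norm z \<le> 1" "Re z \<ge> 0" for z
    using Re_Arctan_nonneg that by (auto simp: h_def)
  have h_eq: "h z = Re (Arctan z)" if "Re z > 0" for z
    using that by (auto simp: h_def)
  \<comment> \<open>The last condition on \<open>z\<close> cuts out a neighbourhood of
    \<open>C\<close>. Where it is an equality, \<open>\<epsilon> * ln (norm (P z)) = - 1\<close>,
    which outweighs \<open>v \<le> pi / 4 < 1\<close>.\<close>
  have key: "v z - h z + \<epsilon> * (ln (norm (P z)) + (norm z)\<^sup>2 - 1) \<le> 0"
    if "\<epsilon> > 0" and z: "norm z \<le> 1" "Re z \<ge> 0" "exp (- 1 / \<epsilon>) \<le> norm (P z)" for \<epsilon> z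
  proof -
    define K where "K = cball 0 1 \<inter> {z. Re z \<ge> 0} \<inter> {z. exp (- 1 / \<epsilon>) \<le> norm (P z)}"
    define k where "k = (\<lambda>z. \<epsilon> * (ln (norm (P z)) + (norm z)\<^sup>2 - 1))"
    define g where "g = (\<lambda>z. v z - h z + k z)"
    have K_P: "P z \<noteq> 0" "norm (P z) > 0" if "z \<in> K" for z
      using that by (auto simp: K_def)
    have K_norm: "norm z \<le> 1" "Re z \<ge> 0" if "z \<in> K" for z
      using that by (auto simp: K_def)
    have k_le: "k z \<le> \<epsilon> * ln (norm (P z))" "k z \<le> 0" if "z \<in> K" for z
    proof -
      have 1: "(norm z)\<^sup>2 \<le> 1"
        using K_norm[OF that] by (simp add: power_le_one)
      then show "k z \<le> \<epsilon> * ln (norm (P z))" using \<open>\<epsilon> > 0\<close> by (simp add: k_def)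
      have "ln (norm (P z)) \<le> 0"
        using P_le K_norm[OF that] K_P[OF that] by simp
      with 1 show "k z \<le> 0" using \<open>\<epsilon> > 0\<close> by (simp add: k_def mult_le_0_iff)
    qed
    have "closed {z. exp (- 1 / \<epsilon>) \<le> norm (P z)}"
      by (intro closed_Collect_le continuous_intros P_cont)
    then have "compact K"
      unfolding K_def
      by (intro compact_Int_closed compact_cball closed_halfspace_Re_ge)
    have "z \<in> K" using z by (simp add: K_def)
    have k_cont: "continuous_on K k"
      unfolding k_def using K_P by (intro continuous_intros P_cont) auto
    have "\<forall>\<^sub>F y in at x within K. g y < b" if "x \<in> K" "g x < b" for x b
    proof -
      have vK: "\<forall>\<^sub>F y in at x within K. v y < b" if "v x < b" for b
      proof -
        have "at x within K \<le> at x within cball 0 1"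
          by (rule at_le) (auto simp: K_def)
        then show ?thesis
          by (rule filter_leD) (rule usc[OF K_norm(1)[OF \<open>x \<in> K\<close>] that])
      qed
      have kK: "(k \<longlongrightarrow> k x) (at x within K)"
        using k_cont \<open>x \<in> K\<close> by (simp add: continuous_on_def)
      show ?thesis
      proof (cases "x = \<i> \<or> x = - \<i>")
        \<comment> \<open>No continuity of \<open>h\<close> is available at a corner. But
          \<open>h\<close> is 0 there and nonnegative on \<open>K\<close>, so
          \<open>g \<le> v + k\<close> on \<open>K\<close> with equality at \<open>x\<close>, and
          semicontinuity of \<open>v + k\<close> suffices.\<close>
        case True
        then have "v x + k x < b"
          using \<open>g x < b\<close> by (auto simp: g_def h_def)
        then have "\<forall>\<^sub>F y in at x within K. v y + k y < b"
          by (intro usc_add_continuous[where v = v and k = k and x = x] vK kK)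
        moreover have "\<forall>\<^sub>F y in at x within K. y \<in> K"
          by (simp add: eventually_at_filter)
        ultimately show ?thesis
        proof eventually_elim
          case (elim y)
          then show ?case using h_nonneg[OF K_norm[of y]] by (simp add: g_def)
        qed
      next
        case False
        \<comment> \<open>The branch cuts of \<open>Arctan\<close> lie on the imaginary axis where
          \<open>\<bar>Im z\<bar> \<ge> 1\<close>; the closed half disc meets them only at the
          corners.\<close>
        have "\<bar>Im x\<bar> < 1" if "Re x = 0"
        proof -
          have "norm x = \<bar>Im x\<bar>" using that by (simp add: cmod_def)
          moreover have "\<bar>Im x\<bar> \<noteq> 1" using that False by (auto simp: complex_eq_iff)
          ultimately show ?thesis using K_norm[OF \<open>x \<in> K\<close>] by simp
        qed
        then have "isCont Arctan x" by (rule continuous_at_Arctan)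
        then have "((\<lambda>z. Re (Arctan z)) \<longlongrightarrow> h x) (at x within K)"
          using False by (auto simp: isCont_def h_def intro!: tendsto_Re intro: tendsto_within_subset)
        moreover have "\<forall>\<^sub>F z in at x within K. Re (Arctan z) = h z"
        proof -
          have "\<forall>\<^sub>F z in at x within K. z \<in> - {\<i>, - \<i>}"
            using False by (intro eventually_at_topological[THEN iffD2] exI[of _ "- {\<i>, - \<i>}"]) auto
          then show ?thesis by eventually_elim (auto simp: h_def)
        qed
        ultimately have "(h \<longlongrightarrow> h x) (at x within K)"
          by (rule Lim_transform_eventually)
        then have "((\<lambda>z. - h z + k z) \<longlongrightarrow> - h x + k x) (at x within K)"
          by (intro tendsto_intros kK)
        moreover have "v x + (- h x + k x) < b" using \<open>g x < b\<close> by (simp add: g_def)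
        ultimately have "\<forall>\<^sub>F y in at x within K. v y + (- h y + k y) < b"
          by (intro usc_add_continuous[where v = v and k = "\<lambda>z. - h z + k z" and x = x] vK)
        then show ?thesis by (simp add: g_def algebra_simps)
      qed
    qed
    then obtain m where m: "m \<in> K" "\<And>y. y \<in> K \<Longrightarrow> g y \<le> g m"
      using usc_attains_max[OF \<open>compact K\<close>, of g] \<open>z \<in> K\<close> by blast
    have "g m \<le> 0"
    proof (rule ccontr)
      assume "\<not> g m \<le> 0"
      then have gm: "g m > 0" by simp
      note Km = K_norm[OF m(1)]
      have A0: "h m \<ge> 0" by (rule h_nonneg[OF Km])
      \<comment> \<open>A positive maximum is excluded in turn on the diameter, on the half circle
        and on the cut around \<open>C\<close>. What remains is an interior maximum, against which
        the submean inequality is used.\<close>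
      have "Re m \<noteq> 0"
        using zero[OF Km(1)] A0 k_le(2)[OF m(1)] gm by (auto simp: g_def)
      then have m1: "Re m > 0" using Km by simp
      have "norm m \<noteq> 1"
        using Re_Arctan_unit_circle[OF _ m1] h_eq[OF m1] bd[OF Km(1)] k_le(2)[OF m(1)] gm by (auto simp: g_def)
      then have m2: "norm m < 1" using Km by simp
      have "norm (P m) \<noteq> exp (- 1 / \<epsilon>)"
      proof
        assume "norm (P m) = exp (- 1 / \<epsilon>)"
        then have "k m \<le> - 1" using k_le(1)[OF m(1)] \<open>\<epsilon> > 0\<close> by simp
        then show False using bd[OF Km(1)] A0 gm pi_less_4 by (simp add: g_def)
      qed
      then have m3: "norm (P m) > exp (- 1 / \<epsilon>)" using m(1) by (auto simp: K_def)
      have "open ({z. norm z < 1} \<inter> {z. Re z > 0} \<inter> {z. norm (P z) > exp (- 1 / \<epsilon>)})"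
        by (intro open_Int open_Collect_less continuous_intros P_cont)
      then obtain R where R: "R > 0"
        "ball m R \<subseteq> {z. norm z < 1} \<inter> {z. Re z > 0} \<inter> {z. norm (P z) > exp (- 1 / \<epsilon>)}"
        using m1 m2 m3 by (metis (no_types, lifting) IntI mem_Collect_eq open_contains_ball)
      then have RK: "ball m R \<subseteq> K" by (force simp: K_def)
      have "m \<notin> C" using K_P[OF m(1)] P_eq_0 by simp
      then obtain R' where R': "R' > 0" "\<And>r. 0 < r \<Longrightarrow> r < R' \<Longrightarrow> submean_at v m (of_real r)"
        using sub[OF m2 m1] by blast
      \<comment> \<open>\<open>P\<close> has no zeros on the ball, so \<open>ln (norm (P w))\<close>
        is the real part of a holomorphic logarithm. This brings \<open>g\<close> into the form
        \<open>v + Re G + \<epsilon> * (norm w)\<^sup>2\<close>.\<close>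
      obtain L where L: "L holomorphic_on ball m R" "\<And>w. w \<in> ball m R \<Longrightarrow> exp (L w) = P w"
      proof (rule holomorphic_logarithm_exists[of "ball m R" P m])
        show "\<And>x. x \<in> ball m R \<Longrightarrow> P x \<noteq> 0" using K_P RK by blast
      qed (use R(1) P_holo in auto)
      have ReL: "ln (norm (P w)) = Re (L w)" if "w \<in> ball m R" for w
        using L(2)[OF that, symmetric] by simp
      define G where "G = (\<lambda>w. - Arctan w + of_real \<epsilon> * L w - of_real \<epsilon>)"
      have "Arctan holomorphic_on ball m R"
        using R(2) by (intro holomorphic_on_Arctan) (force simp: subset_iff)
      then have G: "G holomorphic_on ball m R"
        unfolding G_def using L(1) by (intro holomorphic_intros)
      have gG: "g w = v w + Re (G w) + \<epsilon> * (norm w)\<^sup>2" if "w \<in> ball m R" for w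
      proof -
        have "Re w > 0" using R(2) that by auto
        from h_eq[OF this] ReL[OF that] show ?thesis
          by (simp add: g_def k_def G_def algebra_simps)
      qed
      define r where "r = min R R' / 2"
      have r: "0 < r" "r < R" "r < R'" using R(1) R'(1) by (auto simp: r_def)
      show False
      proof (rule strict_max_contradiction[OF G r(1,2) \<open>\<epsilon> > 0\<close> R'(2)[OF r(1,3)]])
        fix w assume "dist w m = r"
        then have w: "w \<in> ball m R" using r by (simp add: dist_commute)
        have "m \<in> ball m R" using R(1) by simp
        then show "v w + Re (G w) + \<epsilon> * (norm w)\<^sup>2 \<le> v m + Re (G m) + \<epsilon> * (norm m)\<^sup>2"
          using gG gG[OF w] m(2)[of w] w RK by (metis subsetD)
      qed
    qed
    with m(2)[OF \<open>z \<in> K\<close>] show ?thesis by (simp add: g_def k_def)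
  qed
  have Px: "norm (P x) > 0" using x P_eq_0 by simp
  define l where "l = ln (norm (P x)) + (norm x)\<^sup>2 - 1"
  have "l \<le> 0"
    using P_le[of x] x Px power_le_one[of "norm x" 2] unfolding l_def by (smt (verit) ln_le_zero_iff norm_ge_zero)
  \<comment> \<open>As \<open>x\<close> lies outside \<open>C\<close>, the cut around
    \<open>C\<close> misses it for all small \<open>\<epsilon>\<close>, and the perturbation
    vanishes in the limit.\<close>
  have ev: "\<forall>\<^sub>F \<epsilon> in at_right (0::real). v x - h x + \<epsilon> * l \<le> 0"
  proof -
    have "((\<lambda>\<epsilon>. exp (- 1 / \<epsilon>)) \<longlongrightarrow> 0) (at_right (0::real))"
      by real_asymp
    then have "\<forall>\<^sub>F \<epsilon> in at_right (0::real). exp (- 1 / \<epsilon>) < norm (P x)"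
      by (rule order_tendstoD(2)[OF _ Px])
    moreover have "\<forall>\<^sub>F \<epsilon> in at_right (0::real). \<epsilon> > 0"
      by (simp add: eventually_at_right_less)
    ultimately show ?thesis
      by eventually_elim (use key x in \<open>auto simp: l_def\<close>)
  qed
  have "((\<lambda>\<epsilon>. v x - h x + \<epsilon> * l) \<longlongrightarrow> v x - h x + 0 * l) (at_right 0)"
    by (intro tendsto_intros)
  from tendsto_upperbound[OF this ev] show ?thesis using h_eq[OF x(2)] by simp
qed


section \<open>Straightening holomorphic curves in a maximal atlas\<close>

lemma has_derivative_vecI:
  fixes f :: "'a::real_normed_vector \<Rightarrow> complex ^ 'n::finite"
  assumes "\<And>i. ((\<lambda>x. f x $ i) has_derivative (\<lambda>v. D v $ i)) (at x)"
  shows "(f has_derivative D) (at x)"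
proof (subst has_derivative_componentwise_within, rule ballI)
  fix b :: "complex ^ 'n" assume "b \<in> Basis"
  then obtain i u where b: "b = axis i u" by (auto simp: Basis_vec_def)
  show "((\<lambda>x. f x \<bullet> b) has_derivative (\<lambda>x. D x \<bullet> b)) (at x)"
    unfolding b inner_axis by (rule has_derivative_inner_left[OF assms])
qed

lemma holomorphic_map_onI:
  fixes f :: "complex ^ 'n::finite \<Rightarrow> complex ^ 'k::finite"
  assumes "\<And>x i. x \<in> S \<Longrightarrow>
    \<exists>D. ((\<lambda>x. f x $ i) has_derivative D) (at x) \<and> (\<forall>c v. D (c *s v) = c * D v)"
  shows "holomorphic_map_on f S"
  unfolding holomorphic_map_on_def
proof
  fix x assume "x \<in> S"
  then have "\<forall>i. \<exists>D. ((\<lambda>x. f x $ i) has_derivative D) (at x) \<and> (\<forall>c v. D (c *s v) = c * D v)"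
    using assms by blast
  from choice[OF this] obtain D where D: "\<And>i. ((\<lambda>x. f x $ i) has_derivative D i) (at x)"
    "\<And>i c v. D i (c *s v) = c * D i v"
    by blast
  have "(f has_derivative (\<lambda>v. \<chi> i. D i v)) (at x)"
    by (rule has_derivative_vecI) (simp add: D(1))
  then show "\<exists>D. (f has_derivative D) (at x) \<and> (\<forall>c v. D (c *s v) = c *s D v)"
    by (intro exI[of _ "\<lambda>v. \<chi> i. D i v"]) (simp add: D(2) vec_eq_iff)
qed

lemma holomorphic_map_on_compose:
  assumes f: "holomorphic_map_on f S" and g: "holomorphic_map_on g T" and "f ` S \<subseteq> T"
  shows "holomorphic_map_on (g \<circ> f) S"
  unfolding holomorphic_map_on_def
proof
  fix x assume x: "x \<in> S"
  obtain D where D: "(f has_derivative D) (at x)" "\<And>c v. D (c *s v) = c *s D v"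
    using f x unfolding holomorphic_map_on_def by blast
  obtain E where E: "(g has_derivative E) (at (f x))" "\<And>c v. E (c *s v) = c *s E v"
    using g x assms(3) unfolding holomorphic_map_on_def by blast
  have "(g \<circ> f has_derivative E \<circ> D) (at x)"
    using D(1) E(1) by (rule diff_chain_at)
  then show "\<exists>D. (g \<circ> f has_derivative D) (at x) \<and> (\<forall>c v. D (c *s v) = c *s D v)"
    using D(2) E(2) by (intro exI[of _ "E \<circ> D"]) simp
qed

lemma holomorphic_map_on_subset:
  "holomorphic_map_on f S \<Longrightarrow> T \<subseteq> S \<Longrightarrow> holomorphic_map_on f T"
  unfolding holomorphic_map_on_def by blast

text \<open>The derivatives in \<open>holomorphic_map_on\<close> are taken over full neighbourhoods,
  hence agreement on an open set is asked for.\<close>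

lemma holomorphic_map_on_cong:
  assumes "holomorphic_map_on f S" "open S" "\<And>x. x \<in> S \<Longrightarrow> f x = g x"
  shows "holomorphic_map_on g S"
  unfolding holomorphic_map_on_def
proof
  fix x assume x: "x \<in> S"
  then obtain D where D: "(f has_derivative D) (at x)" "\<forall>c v. D (c *s v) = c *s D v"
    using assms(1) unfolding holomorphic_map_on_def by blast
  have "(g has_derivative D) (at x)"
    using D(1) assms(2) x assms(3) by (rule has_derivative_transform_within_open)
  with D(2) show "\<exists>D. (g has_derivative D) (at x) \<and> (\<forall>c v. D (c *s v) = c *s D v)" by blast
qed

lemma holomorphic_map_on_imp_continuous_on:
  assumes "holomorphic_map_on f S"
  shows "continuous_on S f"
  using assms unfolding holomorphic_map_on_def
  by (blast intro: continuous_at_imp_continuous_on has_derivative_continuous)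

lemma has_derivative_holomorphic_coordinate:
  assumes "G holomorphic_on B" "open B" "x $ k \<in> B"
  shows "((\<lambda>x. G (x $ k)) has_derivative (\<lambda>v. deriv G (x $ k) * v $ k)) (at x)"
proof -
  have "(G has_derivative (*) (deriv G (x $ k))) (at (x $ k))"
    using holomorphic_derivI[OF assms] by (simp add: has_field_derivative_def)
  from diff_chain_at[OF bounded_linear_imp_has_derivative[OF bounded_linear_vec_nth] this]
  show ?thesis by (simp add: o_def)
qed

section \<open>Charts and their inverses\<close>

lemma is_chartD:
  assumes "is_chart c"
  shows "open (fst c)" "open (snd c ` fst c)" "continuous_on (fst c) (snd c)" "inj_on (snd c) (fst c)"
    "continuous_on (snd c ` fst c) (inv_into (fst c) (snd c))"
proof -
  obtain \<psi> where c: "open (fst c)" "open (snd c ` fst c)"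
    and h: "homeomorphism (fst c) (snd c ` fst c) (snd c) \<psi>"
    using assms by (auto simp: is_chart_def split: prod.splits)
  from c show "open (fst c)" "open (snd c ` fst c)" .
  from h show "continuous_on (fst c) (snd c)" by (simp add: homeomorphism_def)
  show i: "inj_on (snd c) (fst c)"
    using h by (intro inj_on_inverseI[of _ \<psi>]) (simp add: homeomorphism_def)
  \<comment> \<open>The inverse \<open>\<psi>\<close> agrees on the image with
    \<open>inv_into\<close>, from which \<open>transition\<close> is built.\<close>
  have "continuous_on (snd c ` fst c) \<psi>" using h by (simp add: homeomorphism_def)
  then show "continuous_on (snd c ` fst c) (inv_into (fst c) (snd c))"
    by (rule continuous_on_eq) (use h i in \<open>auto simp: homeomorphism_def\<close>)
qed

lemma is_chartI:
  assumes "open U" "open (\<phi> ` U)" "continuous_on U \<phi>" "inj_on \<phi> U"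
    "continuous_on (\<phi> ` U) (inv_into U \<phi>)"
  shows "is_chart (U, \<phi>)"
proof -
  have "homeomorphism U (\<phi> ` U) \<phi> (inv_into U \<phi>)"
    using assms by (auto simp: homeomorphism_def)
  then show ?thesis using assms(1,2) by (auto simp: is_chart_def)
qed

lemma open_chart_image:
  assumes "is_chart c" "open W"
  shows "open (snd c ` (fst c \<inter> W))"
proof -
  note c = is_chartD[OF assms(1)]
  have "snd c ` (fst c \<inter> W) = snd c ` fst c \<inter> inv_into (fst c) (snd c) -` W"
    using c(4) by auto
  then show ?thesis
    using continuous_open_preimage[OF c(5,2) assms(2)] by simp
qed

text \<open>A holomorphic curve whose \<open>k\<close>-th coordinate is injective is straightened to the \<open>k\<close>-th
  coordinate axis by the shear that inverts the \<open>k\<close>-th coordinate and subtracts the others; since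
  the atlas is maximal, the sheared chart belongs to it.\<close>

lemma straightening_chart:
  fixes M :: "('m::{t2_space, second_countable_topology}, 'n::finite) chart set"
    and g :: "complex \<Rightarrow> complex ^ 'n"
  assumes M: "complex_structure M" and c: "c \<in> M"
    and B: "open B" and g: "\<And>i. (\<lambda>z. g z $ i) holomorphic_on B"
    and inj: "inj_on (\<lambda>z. g z $ k) B"
  obtains d where "d \<in> M"
    "\<And>x z. x \<in> fst c \<Longrightarrow> z \<in> B \<Longrightarrow> snd c x = g z \<Longrightarrow> x \<in> fst d \<and> snd d x = axis k z"
proof -
  have charts: "\<And>e. e \<in> M \<Longrightarrow> is_chart e" and compat: "\<And>e e'. e \<in> M \<Longrightarrow> e' \<in> M \<Longrightarrow> compatible e e'"
    using M unfolding complex_structure_def by blast+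
  define W where "W = (\<lambda>z. g z $ k) ` B"
  have W: "open W"
    unfolding W_def by (rule open_mapping_thm3[OF g B inj])
  obtain q where q: "q holomorphic_on W" "\<And>z. z \<in> B \<Longrightarrow> q (g z $ k) = z"
    unfolding W_def using holomorphic_has_inverse[OF g B inj] by metis
  have qW: "q w \<in> B" "g (q w) $ k = w" if "w \<in> W" for w
    using that q(2) by (auto simp: W_def)
  \<comment> \<open>\<open>\<Psi>\<close> carries \<open>axis k z\<close> to \<open>g z\<close>;
    \<open>\<Theta>\<close> is its explicit inverse between the cylinders \<open>SB\<close> over
    \<open>B\<close> and \<open>SW\<close> over \<open>W\<close>.\<close>
  define \<Psi> where "\<Psi> = (\<lambda>\<zeta>::complex ^ 'n. \<chi> i. if i = k then g (\<zeta> $ k) $ k else \<zeta> $ i + g (\<zeta> $ k) $ i)"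
  define \<Theta> where "\<Theta> = (\<lambda>y::complex ^ 'n. \<chi> i. if i = k then q (y $ k) else y $ i - g (q (y $ k)) $ i)"
  define SB where "SB = {\<zeta>::complex ^ 'n. \<zeta> $ k \<in> B}"
  define SW where "SW = {y::complex ^ 'n. y $ k \<in> W}"
  have SB: "open SB" and SW: "open SW"
    using open_vimage_vec_nth[OF B, of k] open_vimage_vec_nth[OF W, of k]
    by (simp_all add: SB_def SW_def vimage_def)
  have \<Psi>\<Theta>: "\<Theta> y \<in> SB" "\<Psi> (\<Theta> y) = y" if "y \<in> SW" for y
    using that qW by (auto simp: SW_def SB_def \<Theta>_def \<Psi>_def vec_eq_iff)
  have \<Theta>\<Psi>: "\<Psi> \<zeta> \<in> SW" "\<Theta> (\<Psi> \<zeta>) = \<zeta>" if "\<zeta> \<in> SB" for \<zeta>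
    using that q by (auto simp: SW_def SB_def \<Theta>_def \<Psi>_def vec_eq_iff W_def)
  have \<Psi>_holo: "holomorphic_map_on \<Psi> SB"
  proof (rule holomorphic_map_onI)
    fix x i assume "x \<in> SB"
    then have "\<And>i. ((\<lambda>x. g (x $ k) $ i) has_derivative (\<lambda>v. deriv (\<lambda>z. g z $ i) (x $ k) * v $ k)) (at x)"
      using has_derivative_holomorphic_coordinate[OF g B] by (simp add: SB_def)
    note * = this[of k] has_derivative_add[OF bounded_linear_imp_has_derivative[OF bounded_linear_vec_nth] this[of i]]
    show "\<exists>D. ((\<lambda>x. \<Psi> x $ i) has_derivative D) (at x) \<and> (\<forall>c v. D (c *s v) = c * D v)"
      using * by (cases "i = k") (auto intro!: exI simp: \<Psi>_def algebra_simps)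
  qed
  have gq: "(\<lambda>w. g (q w) $ i) holomorphic_on W" for i
    using holomorphic_on_compose_gen[OF q(1) g, of i] qW by (auto simp: o_def)
  have \<Theta>_holo: "holomorphic_map_on \<Theta> SW"
  proof (rule holomorphic_map_onI)
    fix x i assume "x \<in> SW"
    then have x: "x $ k \<in> W" by (simp add: SW_def)
    note * = has_derivative_holomorphic_coordinate[OF q(1) W x]
      has_derivative_diff[OF bounded_linear_imp_has_derivative[OF bounded_linear_vec_nth]
        has_derivative_holomorphic_coordinate[OF gq[of i] W x]]
    show "\<exists>D. ((\<lambda>x. \<Theta> x $ i) has_derivative D) (at x) \<and> (\<forall>c v. D (c *s v) = c * D v)"
      using * by (cases "i = k") (auto intro!: exI simp: \<Theta>_def algebra_simps)
  qed
  note \<Psi>_cont = holomorphic_map_on_imp_continuous_on[OF \<Psi>_holo]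
  note \<Theta>_cont = holomorphic_map_on_imp_continuous_on[OF \<Theta>_holo]
  note cD = is_chartD[OF charts[OF c]]
  \<comment> \<open>The domain of \<open>c\<close> is cut down to where \<open>\<Theta>\<close>
    inverts \<open>\<Psi>\<close>; the points on the curve \<open>g\<close> remain, since
    \<open>g z $ k\<close> lies in \<open>W\<close>.\<close>
  define U where "U = {x \<in> fst c. snd c x \<in> SW}"
  define \<phi> where "\<phi> = \<Theta> \<circ> snd c"
  have U_sub: "U \<subseteq> fst c" by (auto simp: U_def)
  have U_open: "open U"
    using continuous_open_preimage[OF cD(3,1) SW] by (simp add: U_def vimage_def Int_def conj_commute)
  have \<phi>_eq: "\<Psi> (\<phi> x) = snd c x" "\<phi> x \<in> SB" if "x \<in> U" for x
    using \<Psi>\<Theta> that by (auto simp: U_def \<phi>_def)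
  have \<phi>_inj: "inj_on \<phi> U"
    using cD(4) \<phi>_eq(1) by (metis (no_types, lifting) U_sub inj_on_def subsetD)
  have \<phi>_image: "\<phi> ` U = {\<zeta> \<in> SB. \<Psi> \<zeta> \<in> snd c ` fst c}"
  proof (intro equalityI subsetI)
    fix \<zeta> assume "\<zeta> \<in> {\<zeta> \<in> SB. \<Psi> \<zeta> \<in> snd c ` fst c}"
    then obtain x where x: "\<zeta> \<in> SB" "x \<in> fst c" "snd c x = \<Psi> \<zeta>" by auto
    then have "x \<in> U" "\<phi> x = \<zeta>" using \<Theta>\<Psi> by (auto simp: U_def \<phi>_def)
    then show "\<zeta> \<in> \<phi> ` U" by blast
  qed (use \<phi>_eq U_sub in auto)
  have \<phi>_open: "open (\<phi> ` U)"
    using continuous_open_preimage[OF \<Psi>_cont SB cD(2)]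
    by (simp add: \<phi>_image vimage_def Int_def)
  have \<phi>_inv: "inv_into U \<phi> \<zeta> = inv_into (fst c) (snd c) (\<Psi> \<zeta>)" if "\<zeta> \<in> \<phi> ` U" for \<zeta>
    using that \<phi>_inj cD(4) U_sub \<phi>_eq by (auto simp: subsetD)
  have chart: "is_chart (U, \<phi>)"
  proof (rule is_chartI[OF U_open \<phi>_open _ \<phi>_inj])
    show "continuous_on U \<phi>"
      unfolding \<phi>_def
      by (rule continuous_on_compose[OF continuous_on_subset[OF cD(3) U_sub] continuous_on_subset[OF \<Theta>_cont]])
         (auto simp: U_def)
    have "continuous_on (\<phi> ` U) (\<lambda>\<zeta>. inv_into (fst c) (snd c) (\<Psi> \<zeta>))"
      by (rule continuous_on_compose2[OF cD(5) continuous_on_subset[OF \<Psi>_cont]]) (auto simp: \<phi>_image)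
    then show "continuous_on (\<phi> ` U) (inv_into U \<phi>)"
      by (rule continuous_on_eq) (simp add: \<phi>_inv)
  qed
  \<comment> \<open>Transitions from and to the new chart are those of \<open>c\<close> composed
    with \<open>\<Psi>\<close> and \<open>\<Theta>\<close>; maximality of the atlas then
    applies.\<close>
  have "compatible (U, \<phi>) e" if e: "e \<in> M" for e
    unfolding compatible_def fst_conv snd_conv
  proof
    note eD = is_chartD[OF charts[OF e]]
    have ce: "holomorphic_map_on (transition c e) (snd c ` (fst c \<inter> fst e))"
      "holomorphic_map_on (transition e c) (snd e ` (fst c \<inter> fst e))"
      using compat[OF c e] by (simp_all add: compatible_def)
    have "holomorphic_map_on (transition c e \<circ> \<Psi>) (\<phi> ` (U \<inter> fst e))"
    proof (rule holomorphic_map_on_compose[OF holomorphic_map_on_subset[OF \<Psi>_holo] ce(1)])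
      show "\<phi> ` (U \<inter> fst e) \<subseteq> SB" using \<phi>_eq by blast
      show "\<Psi> ` \<phi> ` (U \<inter> fst e) \<subseteq> snd c ` (fst c \<inter> fst e)"
        using \<phi>_eq(1) U_sub by (auto simp: subsetD)
    qed
    then show "holomorphic_map_on (transition (U, \<phi>) e) (\<phi> ` (U \<inter> fst e))"
    proof (rule holomorphic_map_on_cong)
      show "open (\<phi> ` (U \<inter> fst e))"
        using open_chart_image[OF chart eD(1)] by simp
      show "(transition c e \<circ> \<Psi>) x = transition (U, \<phi>) e x" if "x \<in> \<phi> ` (U \<inter> fst e)" for x
        using that \<phi>_inv[of x] by (auto simp: transition_def)
    qed
    have "holomorphic_map_on (\<Theta> \<circ> transition e c) (snd e ` (U \<inter> fst e))"
    proof (rule holomorphic_map_on_compose[OF holomorphic_map_on_subset[OF ce(2)] \<Theta>_holo])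
      show "snd e ` (U \<inter> fst e) \<subseteq> snd e ` (fst c \<inter> fst e)" using U_sub by blast
      show "transition e c ` snd e ` (U \<inter> fst e) \<subseteq> SW"
        using eD(4) by (auto simp: transition_def U_def)
    qed
    then show "holomorphic_map_on (transition e (U, \<phi>)) (snd e ` (U \<inter> fst e))"
      by (simp add: transition_def \<phi>_def o_assoc)
  qed
  with chart have "(U, \<phi>) \<in> M"
    using M unfolding complex_structure_def by blast
  moreover have "x \<in> fst (U, \<phi>) \<and> snd (U, \<phi>) x = axis k z"
    if x: "x \<in> fst c" "z \<in> B" "snd c x = g z" for x z
    using x q(2) by (auto simp: U_def \<phi>_def SW_def W_def \<Theta>_def axis_def vec_eq_iff)
  ultimately show thesis by (rule that)
qed

lemma chart_exists:
  assumes "complex_structure M"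
  obtains c where "c \<in> M" "p \<in> fst c"
  using assms unfolding complex_structure_def by blast


section \<open>Plurisubharmonic functions along holomorphic discs\<close>

lemma open_disc_preimage:
  assumes "holomorphic_disc M f" "open U"
  shows "open {z \<in> ball 0 1. f z \<in> U}"
  using assms continuous_open_preimage[of "ball 0 1" f U]
  by (simp add: holomorphic_disc_def vimage_def Int_def)

lemma holomorphic_disc_coordinate:
  assumes "holomorphic_disc M f" "c \<in> M"
  shows "(\<lambda>z. snd c (f z) $ i) holomorphic_on {z \<in> ball 0 1. f z \<in> fst c}"
  using assms by (auto simp: holomorphic_disc_def split: prod.splits)

lemma plurisubharmonic_usc:
  assumes M: "complex_structure M" and u: "plurisubharmonic M u"
  shows "open {x. u x < b}"
proof -
  have "open {x \<in> fst c. u x < b}" if "c \<in> M" for c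
  proof -
    have c: "is_chart c" using M that by (auto simp: complex_structure_def)
    note cD = is_chartD[OF c]
    have "open {y \<in> snd c ` fst c. (u \<circ> inv_into (fst c) (snd c)) y < b}" (is "open ?Y")
      using u that by (auto simp: plurisubharmonic_def plurisubharmonic_on_def split: prod.splits)
    then have "open (fst c \<inter> snd c -` ?Y)"
      by (rule continuous_open_preimage[OF cD(3,1)])
    also have "fst c \<inter> snd c -` ?Y = {x \<in> fst c. u x < b}"
    proof -
      have "snd c x \<in> ?Y \<longleftrightarrow> u x < b" if "x \<in> fst c" for x
        using that inv_into_f_f[OF cD(4) that] by simp
      then show ?thesis by blast
    qed
    finally show ?thesis .
  qed
  then have "open (\<Union>c\<in>M. {x \<in> fst c. u x < b})" by blast
  also have "(\<Union>c\<in>M. {x \<in> fst c. u x < b}) = {x. u x < b}"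
    using M unfolding complex_structure_def by blast
  finally show ?thesis .
qed

section \<open>Regular and critical points of a holomorphic disc\<close>

definition regular_point :: "('m::topological_space, 'n::finite) chart set \<Rightarrow> (complex \<Rightarrow> 'm) \<Rightarrow> complex \<Rightarrow> bool" where
  "regular_point M f z \<longleftrightarrow> (\<exists>c\<in>M. f z \<in> fst c \<and> (\<exists>i. deriv (\<lambda>z. snd c (f z) $ i) z \<noteq> 0))"

text \<open>Plurisubharmonicity tests only affine discs in charts. A nonzero derivative makes one
  coordinate of \<open>f\<close> locally injective, and in the straightened chart \<open>f\<close>
  is \<open>axis k z\<close>, so a small disc about \<open>z0\<close> becomes affine with direction
  \<open>axis k a\<close>.\<close>

lemma submean_at_regular_point:
  assumes M: "complex_structure M" and u: "plurisubharmonic M u" and f: "holomorphic_disc M f"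
    and z0: "norm z0 < 1" "regular_point M f z0"
  obtains R where "R > 0" "\<And>a. norm a < R \<Longrightarrow> submean_at (u \<circ> f) z0 a"
proof -
  obtain c k where c: "c \<in> M" "f z0 \<in> fst c" "deriv (\<lambda>z. snd c (f z) $ k) z0 \<noteq> 0"
    using z0(2) unfolding regular_point_def by blast
  have charts: "\<And>e. e \<in> M \<Longrightarrow> is_chart e"
    using M by (auto simp: complex_structure_def)
  define S where "S = {z \<in> ball 0 1. f z \<in> fst c}"
  have S: "open S"
    unfolding S_def by (rule open_disc_preimage[OF f is_chartD(1)[OF charts[OF c(1)]]])
  have holo: "(\<lambda>z. snd c (f z) $ i) holomorphic_on S" for i
    unfolding S_def by (rule holomorphic_disc_coordinate[OF f c(1)])
  have "z0 \<in> S" using z0 c by (simp add: S_def)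
  then obtain R where R: "R > 0" "ball z0 R \<subseteq> S" "inj_on (\<lambda>z. snd c (f z) $ k) (ball z0 R)"
    using has_complex_derivative_locally_injective[OF holo _ S c(3)] by blast
  obtain d where d: "d \<in> M"
    and straight: "\<And>x z. x \<in> fst c \<Longrightarrow> z \<in> ball z0 R \<Longrightarrow> snd c x = snd c (f z) \<Longrightarrow> x \<in> fst d \<and> snd d x = axis k z"
    using straightening_chart[OF M c(1) open_ball holomorphic_on_subset[OF holo R(2)] R(3)] by blast
  have fd: "f z \<in> fst d" "snd d (f z) = axis k z" if "z \<in> ball z0 R" for z
    using straight[of "f z" z] that R(2) by (auto simp: S_def)
  have inv: "inv_into (fst d) (snd d) (axis k z) = f z" if "z \<in> ball z0 R" for z
    using fd[OF that] inv_into_f_f[OF is_chartD(4)[OF charts[OF d]]] by metis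
  have psh: "plurisubharmonic_on (u \<circ> inv_into (fst d) (snd d)) (snd d ` fst d)"
    using u d by (auto simp: plurisubharmonic_def split: prod.splits)
  have "submean_at (u \<circ> f) z0 a" if a: "norm a < R" for a
  proof -
    have line: "axis k z0 + \<zeta> *s axis k a = axis k (z0 + a * \<zeta>)" for \<zeta>
      by (simp add: vec_eq_iff axis_def)
    have in_ball: "z0 + a * \<zeta> \<in> ball z0 R" if "norm \<zeta> \<le> 1" for \<zeta>
      using a that mult_left_le[of "norm \<zeta>" "norm a"] by (simp add: dist_norm norm_mult)
    have "axis k z0 + \<zeta> *s axis k a \<in> snd d ` fst d" if "norm \<zeta> \<le> 1" for \<zeta>
      unfolding line using fd[OF in_ball[OF that]] by (metis imageI)
    then have "set_integrable lborel {0..2 * pi} (\<lambda>\<theta>. (u \<circ> inv_into (fst d) (snd d)) (axis k z0 + cis \<theta> *s axis k a)) \<and>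
       (u \<circ> inv_into (fst d) (snd d)) (axis k z0) \<le>
       (LBINT \<theta>:{0..2 * pi}. (u \<circ> inv_into (fst d) (snd d)) (axis k z0 + cis \<theta> *s axis k a)) / (2 * pi)"
      using psh unfolding plurisubharmonic_on_def by blast
    then show ?thesis
      using inv[OF in_ball] inv[of z0] R(1) by (simp add: line submean_at_def)
  qed
  with R(1) show thesis by (rule that)
qed

text \<open>In a chart around \<open>f z\<close>, either the derivative of some coordinate is not
  identically 0 near \<open>z\<close> and its zeros are isolated, or all these derivatives vanish
  and \<open>f\<close> is locally constant.\<close>

lemma eventually_regular_or_eventually_critical:
  assumes M: "complex_structure M" and f: "holomorphic_disc M f" and z: "norm z < 1"
  shows "(\<forall>\<^sub>F y in at z. regular_point M f y) \<or> (\<forall>\<^sub>F y in nhds z. \<not> regular_point M f y)"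
proof -
  obtain c where c: "c \<in> M" "f z \<in> fst c" using chart_exists[OF M] .
  have cD: "open (fst c)" "inj_on (snd c) (fst c)"
    using M c is_chartD(1,4)[of c] by (auto simp: complex_structure_def)
  have "z \<in> {z \<in> ball 0 1. f z \<in> fst c}" using z c by simp
  then obtain R where R: "R > 0" "ball z R \<subseteq> {z \<in> ball 0 1. f z \<in> fst c}"
    using open_disc_preimage[OF f cD(1)] open_contains_ball by blast
  have holo: "(\<lambda>z. snd c (f z) $ i) holomorphic_on ball z R" for i
    using holomorphic_disc_coordinate[OF f c(1)] R(2) by (rule holomorphic_on_subset)
  have zR: "z \<in> ball z R" using R by simp
  show ?thesis
  proof (cases "\<exists>i. \<exists>\<beta>\<in>ball z R. deriv (\<lambda>z. snd c (f z) $ i) \<beta> \<noteq> 0")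
    case True
    then obtain i \<beta> where "\<beta> \<in> ball z R" "deriv (\<lambda>z. snd c (f z) $ i) \<beta> \<noteq> 0" by blast
    from non_zero_neighbour_alt[OF holomorphic_deriv[OF holo open_ball] open_ball connected_ball zR this]
    have "\<forall>\<^sub>F y in at z. regular_point M f y"
    proof eventually_elim
      case (elim y)
      then have "f y \<in> fst c" using R(2) by auto
      with elim c(1) show ?case unfolding regular_point_def by blast
    qed
    then show ?thesis ..
  next
    case False
    have const: "f y = f z" if y: "y \<in> ball z R" for y
    proof -
      have "snd c (f y) $ i = snd c (f z) $ i" for i
      proof (rule has_field_derivative_zero_constant[of "ball z R" "\<lambda>z. snd c (f z) $ i", THEN exE])
        fix x assume "x \<in> ball z R"
        then show "((\<lambda>z. snd c (f z) $ i) has_field_derivative 0) (at x within ball z R)"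
          using holomorphic_derivI[OF holo open_ball, of x i] False by simp
      qed (use y zR in auto)
      then have "snd c (f y) = snd c (f z)" by (simp add: vec_eq_iff)
      moreover have "f y \<in> fst c" using y R(2) by auto
      ultimately show ?thesis using c(2) by (rule inj_onD[OF cD(2)])
    qed
    \<comment> \<open>Regularity could be witnessed by any chart \<open>e\<close>, so it is the
      constancy of \<open>f\<close> itself that rules it out.\<close>
    have "\<not> regular_point M f y" if y: "y \<in> ball z R" for y
    proof -
      have "deriv (\<lambda>z. snd e (f z) $ i) y = 0" if "e \<in> M" for e i
      proof (rule DERIV_imp_deriv)
        show "((\<lambda>z. snd e (f z) $ i) has_field_derivative 0) (at y)"
        proof (rule has_field_derivative_transform_within_open)
          show "((\<lambda>_. snd e (f z) $ i) has_field_derivative 0) (at y)" by simp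
          show "snd e (f z) $ i = snd e (f x) $ i" if "x \<in> ball z R" for x
            by (simp only: const[OF that])
        qed (use y in simp_all)
      qed
      then show ?thesis by (simp add: regular_point_def)
    qed
    then have "\<forall>\<^sub>F y in nhds z. \<not> regular_point M f y"
      using R(1) by (auto simp: eventually_nhds_metric dist_commute)
    then show ?thesis ..
  qed
qed

text \<open>The identity theorem by connectedness: \<open>Z\<close> and \<open>Y\<close> are open
  and disjoint and cover the disc, and \<open>Y\<close> contains 0.\<close>

lemma critical_points_discrete:
  assumes M: "complex_structure M" and f: "holomorphic_disc M f"
    and reg: "regular_point M f 0" and z: "norm z < 1"
  shows "\<forall>\<^sub>F y in at z. regular_point M f y"
proof -
  define Z where "Z = {z \<in> ball 0 1. \<forall>\<^sub>F y in nhds z. \<not> regular_point M f y}"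
  define Y where "Y = {z \<in> ball 0 1. \<forall>\<^sub>F y in at z. regular_point M f y}"
  have "open Z"
  proof (subst open_subopen, rule ballI)
    fix x assume x: "x \<in> Z"
    then obtain T where T: "open T" "x \<in> T" "\<And>y. y \<in> T \<Longrightarrow> \<not> regular_point M f y"
      unfolding Z_def eventually_nhds by blast
    have "T \<inter> ball 0 1 \<subseteq> Z"
      unfolding Z_def eventually_nhds using T(1,3) by blast
    moreover have "x \<in> T \<inter> ball 0 1" using x T(2) unfolding Z_def by blast
    ultimately show "\<exists>T. open T \<and> x \<in> T \<and> T \<subseteq> Z"
      using open_Int[OF T(1) open_ball] by blast
  qed
  moreover have "open Y"
  proof (subst open_subopen, rule ballI)
    fix x assume x: "x \<in> Y"
    then obtain T where T: "open T" "x \<in> T" "\<And>y. y \<in> T \<Longrightarrow> y \<noteq> x \<Longrightarrow> regular_point M f y"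
      unfolding Y_def eventually_at_topological by blast
    have "y \<in> Y" if y: "y \<in> T \<inter> ball 0 1" for y
    proof (cases "y = x")
      case False
      then have "open (T - {x})" "y \<in> T - {x}" using T y by auto
      then show ?thesis unfolding Y_def eventually_at_topological using T(3) y by blast
    qed (use x in simp)
    moreover have "x \<in> T \<inter> ball 0 1" using x T(2) unfolding Y_def by blast
    ultimately show "\<exists>T. open T \<and> x \<in> T \<and> T \<subseteq> Y"
      using open_Int[OF T(1) open_ball] by blast
  qed
  moreover have "Z \<inter> Y = {}"
  proof -
    have "\<not> ((\<forall>\<^sub>F y in nhds z. \<not> regular_point M f y) \<and> (\<forall>\<^sub>F y in at z. regular_point M f y))" for z
    proof
      assume "(\<forall>\<^sub>F y in nhds z. \<not> regular_point M f y) \<and> (\<forall>\<^sub>F y in at z. regular_point M f y)"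
      then have "\<forall>\<^sub>F y in at z. \<not> regular_point M f y" "\<forall>\<^sub>F y in at z. regular_point M f y"
        using filter_leD[OF at_within_le_nhds] by blast+
      then have "\<forall>\<^sub>F y in at z. False" by eventually_elim simp
      then show False by simp
    qed
    then show ?thesis unfolding Z_def Y_def by blast
  qed
  moreover have "ball 0 1 \<subseteq> Z \<union> Y"
  proof
    fix x :: complex assume x: "x \<in> ball 0 1"
    then have "norm x < 1" by simp
    from eventually_regular_or_eventually_critical[OF M f this] x show "x \<in> Z \<union> Y"
      unfolding Z_def Y_def by blast
  qed
  ultimately have "Z \<inter> ball 0 1 = {} \<or> Y \<inter> ball 0 1 = {}"
    by (intro connectedD) auto
  moreover have "0 \<in> Y"
  proof -
    have "0 \<notin> Z" using reg eventually_nhds_x_imp_x unfolding Z_def by blast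
    moreover have "(0::complex) \<in> ball 0 1" by simp
    ultimately show ?thesis using \<open>ball 0 1 \<subseteq> Z \<union> Y\<close> by blast
  qed
  ultimately have "Z = {}" unfolding Z_def Y_def by blast
  moreover have "z \<in> ball 0 1" using z by simp
  ultimately show ?thesis using \<open>ball 0 1 \<subseteq> Z \<union> Y\<close> unfolding Y_def by blast
qed

text \<open>Multiplication by \<open>e = \<i> * r\<close> turns the right half disc into the upper
  half disc of radius \<open>r\<close>. Taking \<open>r < 1\<close> keeps the closed disc inside the
  domain of \<open>f\<close>, with finitely many critical points; at the end \<open>r\<close> tends
  to 1.\<close>

lemma disc_bound_regular:
  assumes M: "complex_structure M" and u: "u \<in> psh_class V M" and f: "holomorphic_disc M f"
    and fV: "\<And>x::real. -1 < x \<Longrightarrow> x < 1 \<Longrightarrow> f (of_real x) \<in> V"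
    and reg: "regular_point M f 0" and s: "0 < s" "s < 1" "regular_point M f (\<i> * of_real s)"
  shows "u (f (\<i> * of_real s)) \<le> s"
proof -
  have psh: "plurisubharmonic M u" and u_le: "\<And>x. u x < pi / 4" and uV: "\<And>p. p \<in> V \<Longrightarrow> u p = 0"
    using u by (auto simp: psh_class_def)
  have bound: "u (f (\<i> * of_real s)) \<le> s / r" if r: "s < r" "r < 1" for r
  proof -
    define e where "e = \<i> * complex_of_real r"
    have r0: "r > 0" using s r by simp
    have norm_e: "norm (e * w) = r * norm w" for w
      using r0 by (simp add: e_def norm_mult)
    have e0: "e \<noteq> 0" using r0 by (simp add: e_def)
    have in_disc: "norm (e * w) < 1" if "norm w \<le> 1" for w
      unfolding norm_e using that r r0 mult_left_le[of "norm w" r] by linarith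
    define v where "v = (\<lambda>w. u (f (e * w)))"
    define C where "C = {w \<in> cball 0 1. \<not> regular_point M f (e * w)}"
    \<comment> \<open>The critical points do not accumulate in the open unit disc, so a compact part
      of it holds finitely many.\<close>
    have "finite (cball 0 r \<inter> {z. \<not> regular_point M f z})"
    proof (rule finite_not_islimpt_in_compact[OF compact_cball])
      fix z :: complex assume "z \<in> cball 0 r"
      then have "norm z < 1" using r by simp
      then have "\<forall>\<^sub>F y in at z. regular_point M f y"
        by (rule critical_points_discrete[OF M f reg])
      then show "\<not> z islimpt {z. \<not> regular_point M f z}"
        by (simp add: islimpt_iff_eventually)
    qed
    moreover have "(*) e ` C \<subseteq> cball 0 r \<inter> {z. \<not> regular_point M f z}"
      using r0 by (auto simp: C_def norm_e mult_left_le)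
    ultimately have "finite ((*) e ` C)" by (rule rev_finite_subset)
    then have C: "finite C"
      by (rule finite_imageD) (use e0 in \<open>auto simp: inj_on_def\<close>)
    \<comment> \<open>The preimage of \<open>\<i> * of_real s\<close> under multiplication by
      \<open>e\<close>; it is real, so \<open>Arctan\<close> reduces to the real
      \<open>arctan\<close>.\<close>
    define x where "x = complex_of_real (s / r)"
    have ex: "e * x = \<i> * of_real s" using r0 by (simp add: e_def x_def)
    have x: "norm x < 1" "Re x > 0" using s r r0 by (simp_all add: x_def norm_divide)
    have "v x \<le> Re (Arctan x)"
    proof (rule half_disc_bound[OF C])
      show "C \<subseteq> cball 0 1" by (auto simp: C_def)
      show "v y \<le> pi / 4" for y using u_le[of "f (e * y)"] by (simp add: v_def)
      show "v y = 0" if "norm y \<le> 1" "Re y = 0" for y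
      proof -
        \<comment> \<open>The imaginary diameter is rotated into the real one, which
          \<open>f\<close> maps into \<open>V\<close>.\<close>
        have "e * y = of_real (- r * Im y)"
          using that by (simp add: e_def complex_eq_iff)
        moreover have "\<bar>- r * Im y\<bar> < 1"
          using in_disc[OF that(1)] unfolding calculation norm_of_real .
        ultimately show ?thesis using uV[OF fV[of "- r * Im y"]] unfolding v_def by (simp only: abs_less_iff) simp
      qed
      show "\<forall>\<^sub>F w in at y within cball 0 1. v w < b" if "norm y \<le> 1" "v y < b" for y b
      proof -
        let ?T = "{z \<in> ball 0 1. f z \<in> {x. u x < b}}"
        have "open ?T" by (rule open_disc_preimage[OF f plurisubharmonic_usc[OF M psh]])
        then have "open ((*) e -` ?T)"
          by (rule open_vimage) (intro continuous_intros)
        moreover have "y \<in> (*) e -` ?T" using that in_disc by (simp add: v_def)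
        ultimately have "\<forall>\<^sub>F w in at y. w \<in> (*) e -` ?T"
          by (metis eventually_at_topological)
        then have "\<forall>\<^sub>F w in at y. v w < b"
          by eventually_elim (simp add: v_def)
        then show ?thesis by (rule filter_leD[OF at_le[OF subset_UNIV]])
      qed
      show "\<exists>R>0. \<forall>\<rho>. 0 < \<rho> \<and> \<rho> < R \<longrightarrow> submean_at v y (of_real \<rho>)"
        if "norm y < 1" "Re y > 0" "y \<notin> C" for y
      proof -
        have "regular_point M f (e * y)" using that by (simp add: C_def)
        moreover have "norm (e * y) < 1" using that by (intro in_disc) simp
        ultimately obtain R where R: "R > 0" "\<And>a. norm a < R \<Longrightarrow> submean_at (u \<circ> f) (e * y) a"
          using submean_at_regular_point[OF M psh f] by blast
        \<comment> \<open>A radius \<open>\<rho>\<close> for \<open>v\<close> is the complex radius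
          \<open>e * of_real \<rho>\<close> for \<open>u \<circ> f\<close>, of norm
          \<open>r * \<rho>\<close>.\<close>
        have "submean_at v y (of_real \<rho>)" if "0 < \<rho>" "\<rho> < R / r" for \<rho>
        proof -
          have "norm (e * of_real \<rho>) < R"
            unfolding norm_e using that r0 by (simp add: field_simps)
          from R(2)[OF this] show ?thesis
            by (simp add: submean_at_def v_def algebra_simps)
        qed
        then show ?thesis using R(1) r0 by (intro exI[of _ "R / r"]) simp
      qed
      show "x \<notin> C" using s(3) by (simp add: C_def ex)
    qed (use x in auto)
    also have "Re (Arctan x) = arctan (s / r)"
      by (simp only: x_def Arctan_of_real Re_complex_of_real)
    also have "\<dots> \<le> s / r" using s r0 by (intro arctan_le_self) simp
    finally show ?thesis by (simp add: v_def ex)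
  qed
  have "((\<lambda>r. s / r) \<longlongrightarrow> s / 1) (at_left 1)"
    by (intro tendsto_intros) auto
  moreover have "\<forall>\<^sub>F r in at_left (1::real). u (f (\<i> * of_real s)) \<le> s / r"
    using eventually_at_left_real[OF s(2)] by eventually_elim (use bound in auto)
  ultimately show ?thesis
    using tendsto_lowerbound[of "\<lambda>r. s / r" "s / 1" "at_left 1" "u (f (\<i> * of_real s))"] by simp
qed

section \<open>The curve along the imaginary axis and the comparison of the pseudometrics\<close>

lemma disc_imaginary_axis_curve:
  assumes charts: "\<And>c. c \<in> M \<Longrightarrow> is_chart c" and f: "holomorphic_disc M f" and "a > 0"
    and vel: "disc_velocity_at_0 M f (\<lambda>c. inverse a *\<^sub>R \<xi> c)"
  shows "(\<lambda>t. f (\<i> * of_real (a * t))) \<in> curves M (f 0) (J \<xi>)"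
proof -
  define \<gamma> where "\<gamma> = (\<lambda>t. f (\<i> * of_real (a * t)))"
  \<comment> \<open>For \<open>\<bar>t\<bar> < 1 / a\<close> the point
    \<open>\<i> * of_real (a * t)\<close> stays in the unit disc.\<close>
  define \<epsilon> where "\<epsilon> = 1 / a"
  have "\<epsilon> > 0" using \<open>a > 0\<close> by (simp add: \<epsilon>_def)
  have in_disc: "\<i> * of_real (a * t) \<in> ball 0 1" if "t \<in> {-\<epsilon><..<\<epsilon>}" for t
  proof -
    have "\<bar>a * t\<bar> < 1"
      using that \<open>a > 0\<close> by (simp add: \<epsilon>_def abs_less_iff field_simps)
    then show ?thesis
      by (simp only: mem_ball dist_0_norm norm_mult norm_ii norm_of_real mult_1)
  qed
  have line: "((\<lambda>t. \<i> * of_real (a * t)) has_vector_derivative \<i> * of_real a) (at t)" for t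
    unfolding has_vector_derivative_def
    by (auto intro!: derivative_eq_intros simp: scaleR_conv_of_real mult_ac)
  have "C1_curve M \<epsilon> \<gamma>"
    unfolding C1_curve_def
  proof (intro conjI ballI)
    have "continuous_on (ball 0 1) f" using f by (simp add: holomorphic_disc_def)
    then show "continuous_on {-\<epsilon><..<\<epsilon>} \<gamma>"
      unfolding \<gamma>_def
      by (rule continuous_on_compose2) (use in_disc in \<open>auto intro!: continuous_intros\<close>)
    fix e assume "e \<in> M"
    obtain U \<phi> where e: "e = (U, \<phi>)" by (cases e)
    define S where "S = {z \<in> ball 0 1. f z \<in> U}"
    have S: "open S"
      unfolding S_def using is_chartD(1)[of e] charts[OF \<open>e \<in> M\<close>] by (intro open_disc_preimage[OF f]) (simp add: e)
    have holo: "(\<lambda>z. \<phi> (f z) $ i) holomorphic_on S" for i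
      using holomorphic_disc_coordinate[OF f \<open>e \<in> M\<close>, of i] by (simp add: e S_def)
    let ?T = "{t \<in> {-\<epsilon><..<\<epsilon>}. \<gamma> t \<in> U}"
    have in_S: "\<i> * of_real (a * t) \<in> S" if "t \<in> ?T" for t
      using that in_disc[of t] by (simp add: S_def \<gamma>_def)
    define D where "D = (\<lambda>t. \<chi> i. \<i> * of_real a * deriv (\<lambda>z. \<phi> (f z) $ i) (\<i> * of_real (a * t)))"
    have "((\<lambda>t. \<phi> (\<gamma> t)) has_vector_derivative D t) (at t)" if "t \<in> ?T" for t
      unfolding has_vector_derivative_def
    proof (rule has_derivative_vecI)
      fix i
      from field_vector_diff_chain_at[OF line holomorphic_derivI[OF holo[of i] S in_S[OF that]]]
      show "((\<lambda>t. \<phi> (\<gamma> t) $ i) has_derivative (\<lambda>h. (h *\<^sub>R D t) $ i)) (at t)"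
        by (simp add: o_def \<gamma>_def D_def has_vector_derivative_def)
    qed
    moreover have "continuous_on ?T D"
      unfolding D_def
    proof (intro continuous_intros)
      fix i
      show "continuous_on ?T (\<lambda>t. deriv (\<lambda>z. \<phi> (f z) $ i) (\<i> * of_real (a * t)))"
        by (rule continuous_on_compose2[OF holomorphic_on_imp_continuous_on[OF holomorphic_deriv[OF holo S]]])
           (use in_S in \<open>auto intro!: continuous_intros\<close>)
    qed
    ultimately have "(\<lambda>t. \<phi> (\<gamma> t)) C1_differentiable_on ?T"
      unfolding C1_differentiable_on_def by blast
    then show "case e of (U, \<phi>) \<Rightarrow> (\<lambda>t. \<phi> (\<gamma> t)) C1_differentiable_on {t \<in> {-\<epsilon><..<\<epsilon>}. \<gamma> t \<in> U}"
      by (simp add: e)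
  qed
  moreover have "((\<lambda>t. snd c (\<gamma> t)) has_vector_derivative J \<xi> c) (at 0)"
    if c: "c \<in> M" "f 0 \<in> fst c" for c
    unfolding has_vector_derivative_def
  proof (rule has_derivative_vecI)
    fix i
    have "((\<lambda>z. snd c (f z) $ i) has_field_derivative inverse a *\<^sub>R \<xi> c $ i) (at (\<i> * of_real (a * 0)))"
      using vel c by (auto simp: disc_velocity_at_0_def)
    \<comment> \<open>The speed \<open>a\<close> of the parametrization cancels
      \<open>inverse a\<close>, and the remaining \<open>\<i>\<close> is the action of
      \<open>J\<close>.\<close>
    from field_vector_diff_chain_at[OF line this]
    have "((\<lambda>t. snd c (\<gamma> t) $ i) has_vector_derivative \<i> * \<xi> c $ i) (at 0)"
      using \<open>a > 0\<close> by (simp add: o_def \<gamma>_def scaleR_conv_of_real field_simps)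
    then show "((\<lambda>t. snd c (\<gamma> t) $ i) has_derivative (\<lambda>t. (t *\<^sub>R J \<xi> c) $ i)) (at 0)"
      by (simp add: has_vector_derivative_def J_def)
  qed
  ultimately show ?thesis
    using \<open>\<epsilon> > 0\<close> unfolding curves_def \<gamma>_def by auto
qed

theorem theorem3p4:
  fixes V :: "'m::{t2_space, second_countable_topology} set"
    and M :: "('m, 'n::finite) chart set"
    and p :: 'm
    and \<xi> :: "('m, 'n) tangent"
  assumes "analytic_pair V M"
    and "p \<in> V"
    and "\<xi> \<in> submanifold_tangent_space M V p"
  shows "E_pair V M p \<xi> \<le> F_pair V M p \<xi>"
  unfolding E_pair_def F_pair_def
proof (intro SUP_least Inf_greatest)
  fix u and A :: ereal
  assume u: "u \<in> psh_class V M"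
    and "A \<in> {ereal a | a::real. a > 0 \<and>
    (\<exists>f. holomorphic_disc M f \<and> (\<forall>x::real. -1 < x \<and> x < 1 \<longrightarrow> f (complex_of_real x) \<in> V) \<and>
         f 0 = p \<and> disc_velocity_at_0 M f (\<lambda>c. inverse a *\<^sub>R \<xi> c))}"
  then obtain a f where A: "A = ereal a" and a: "a > 0" and f: "holomorphic_disc M f"
    and fV: "\<And>x::real. -1 < x \<Longrightarrow> x < 1 \<Longrightarrow> f (complex_of_real x) \<in> V"
    and f0: "f 0 = p" and vel: "disc_velocity_at_0 M f (\<lambda>c. inverse a *\<^sub>R \<xi> c)"
    by blast
  have M: "complex_structure M" using assms(1) by (simp add: analytic_pair_def)
  have \<xi>: "\<xi> \<in> tangent_space M p" using assms(3) by (simp add: submanifold_tangent_space_def)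
  have E_le: "E_fun u M p \<xi> \<le> ereal a"
    if "\<gamma> \<in> curves M p (J \<xi>)" "\<forall>\<^sub>F t in at_right 0. u (\<gamma> t) / t \<le> a" for \<gamma>
    unfolding E_fun_def
  proof (rule INF_lower2[OF that(1)])
    show "Limsup (at_right 0) (\<lambda>t. ereal (u (\<gamma> t) / t)) \<le> ereal a"
      using that(2) by (intro Limsup_bounded) simp
  qed
  show "E_fun u M p \<xi> \<le> A"
  proof (cases "\<xi> = (\<lambda>c. 0)")
    case True
    \<comment> \<open>For \<open>\<xi> = 0\<close> the disc may be constant, without regular points.
      The constant curve has velocity \<open>J \<xi> = 0\<close>, and \<open>u\<close> vanishes
      along it.\<close>
    have "(\<lambda>t. p) \<in> curves M p (J \<xi>)"
      using True by (auto simp: curves_def C1_curve_def J_def split: prod.splits intro: exI[of _ 1])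
    moreover have "u p = 0" using u assms(2) by (simp add: psh_class_def)
    ultimately show ?thesis using E_le[of "\<lambda>t. p"] a by (simp add: A)
  next
    case False
    then obtain c where "\<xi> c \<noteq> 0" by (meson ext)
    \<comment> \<open>Tangent vectors are normalized to 0 on all other charts, so
      \<open>\<xi> c \<noteq> 0\<close> forces \<open>c\<close> to be a chart around
      \<open>p\<close>.\<close>
    with \<xi> have c: "c \<in> M" "f 0 \<in> fst c" unfolding tangent_space_def f0 by blast+
    from \<open>\<xi> c \<noteq> 0\<close> obtain i where "\<xi> c $ i \<noteq> 0" by (auto simp: vec_eq_iff)
    moreover have "deriv (\<lambda>z. snd c (f z) $ i) 0 = inverse a *\<^sub>R \<xi> c $ i"
      using vel c by (intro DERIV_imp_deriv) (auto simp: disc_velocity_at_0_def)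
    ultimately have "deriv (\<lambda>z. snd c (f z) $ i) 0 \<noteq> 0"
      using a by simp
    then have reg: "regular_point M f 0"
      using c unfolding regular_point_def by blast
    \<comment> \<open>The pointwise bound is available at regular points only; a punctured
      neighbourhood of 0 consists of them, which is enough for an upper limit at 0.\<close>
    have "\<forall>\<^sub>F y in at 0. regular_point M f y"
      by (rule critical_points_discrete[OF M f reg]) simp
    moreover have "filterlim (\<lambda>t. \<i> * of_real (a * t)) (at 0) (at_right 0)"
      unfolding filterlim_at
    proof
      show "((\<lambda>t. \<i> * complex_of_real (a * t)) \<longlongrightarrow> 0) (at_right 0)"
        by (auto intro!: tendsto_eq_intros)
      show "\<forall>\<^sub>F t in at_right 0. \<i> * complex_of_real (a * t) \<in> UNIV \<and> \<i> * complex_of_real (a * t) \<noteq> 0"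
        using a by (auto simp: eventually_at_filter)
    qed
    ultimately have "\<forall>\<^sub>F t in at_right 0. regular_point M f (\<i> * of_real (a * t))"
      by (simp add: filterlim_iff)
    moreover have "\<forall>\<^sub>F t in at_right 0. 0 < t \<and> t < 1 / a"
      using a eventually_at_right_real[of 0 "1 / a"] by simp
    ultimately have "\<forall>\<^sub>F t in at_right 0. u (f (\<i> * of_real (a * t))) / t \<le> a"
    proof eventually_elim
      case (elim t)
      then have "u (f (\<i> * of_real (a * t))) \<le> a * t"
        using a by (intro disc_bound_regular[OF M u f fV reg]) (auto simp: field_simps)
      then show ?case using elim by (simp add: field_simps)
    qed
    moreover have "(\<lambda>t. f (\<i> * of_real (a * t))) \<in> curves M p (J \<xi>)"
      using disc_imaginary_axis_curve[OF _ f a vel] M by (auto simp: complex_structure_def f0)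
    ultimately show ?thesis using E_le by (simp add: A)
  qed
qed

end
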